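(* Let $\{x^k\}$ be the sequence generated by PACA (the algorithm described in the context) for convex functions $f_1,\dots,f_m:\mathbb{R}^n\to\mathbb{R}$, an arbitrary starting point $x^0\in\mathbb{R}^n$ and perturbation parameters $\{\epsilon_k\}$. Assume the Slater condition: there exists $\hat x\in\mathbb{R}^n$ with $f_i(\hat x)<0$ for all $i=1,\dots,m$. If the sequence $\{\epsilon_k\}$ decreases to $0$ and $\sum_{k=0}^\infty \epsilon_k=\infty$, then PACA has finite termination, i.e., there exists some index $k$ such that $x^k\in C=\bigcap_{i=1}^m C_i$.
   Context: Setting. $m,n\ge 1$; $f_i:\mathbb{R}^n\to\mathbb{R}$ is convex for $i=1,\dots,m$; $C_i=\{x\in\mathbb{R}^n: f_i(x)\le 0\}$ and $C=\bigcap_{i=1}^m C_i$. $\|\cdot\|$ is the Euclidean norm and $\partial f_i(x)$ is the convex subdifferential. $\{\epsilon_k\}_{k\ge 0}$ is a decreasing sequence of positive reals ($\epsilon_{k+1}<\epsilon_k$) converging to $0$. PACA (Perturbed Approximate Circumcenter Algorithm). Start from $x^0\in\mathbb{R}^n$. Given $x^k$: if $x^k\in C$, stop. Otherwise choose arbitrary $u_i^k\in\partial f_i(x^k)$ for $i=1,\dots,m$, and set $$v_i^k=\frac{\max\{0,f_i(x^k)+\epsilon_k\}}{\|u_i^k\|^2}\,u_i^k,\qquad w^k=\frac1m\sum_{i=1}^m v_i^k .$$ If $w^k=0$, put $x^{k+1}=x^k$ and go to iteration $k+1$. Otherwise put $$\alpha_k=\frac{\frac1m\sum_{i=1}^m\|v_i^k\|^2}{\|w^k\|^2},\qquad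 x^{k+1}=x^k-\alpha_k w^k .$$ Here $v_i^k=0$ whenever $f_i(x^k)+\epsilon_k\le 0$, and it is understood that the iterates are well defined, i.e. $u_i^k\ne 0$ whenever $f_i(x^k)+\epsilon_k>0$. *)

theory Defs
  imports "HOL-Analysis.Analysis"
begin

definition subdifferential :: "('a::real_inner \<Rightarrow> real) \<Rightarrow> 'a \<Rightarrow> 'a set" where
  "subdifferential f x = {u. \<forall>y. f x + u \<bullet> (y - x) \<le> f y}"

definition feasible_set :: "nat \<Rightarrow> (nat \<Rightarrow> 'a \<Rightarrow> real) \<Rightarrow> 'a set" where
  "feasible_set m f = (\<Inter>i\<in>{1..m}. {x. f i x \<le> 0})"

text \<open>
  In the next four definitions \<open>f\<close> is the family of functions, \<open>e\<close> the current perturbation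
  parameter, \<open>x\<close> the current iterate and \<open>u i\<close> the chosen subgradient of \<open>f i\<close> at \<open>x\<close>.
  If \<open>f i x + e \<le> 0\<close> then \<open>paca_v f e x u i = 0\<close>, also when \<open>u i = 0\<close>, because \<open>0 / 0 = 0\<close>.
\<close>

definition paca_v :: "(nat \<Rightarrow> 'a::real_inner \<Rightarrow> real) \<Rightarrow> real \<Rightarrow> 'a \<Rightarrow> (nat \<Rightarrow> 'a) \<Rightarrow> nat \<Rightarrow> 'a" where
  "paca_v f e x u i = (max 0 (f i x + e) / (norm (u i))\<^sup>2) *\<^sub>R u i"

definition paca_w :: "nat \<Rightarrow> (nat \<Rightarrow> 'a::real_inner \<Rightarrow> real) \<Rightarrow> real \<Rightarrow> 'a \<Rightarrow> (nat \<Rightarrow> 'a) \<Rightarrow> 'a" where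
  "paca_w m f e x u = (1 / real m) *\<^sub>R (\<Sum>i=1..m. paca_v f e x u i)"

definition paca_alpha :: "nat \<Rightarrow> (nat \<Rightarrow> 'a::real_inner \<Rightarrow> real) \<Rightarrow> real \<Rightarrow> 'a \<Rightarrow> (nat \<Rightarrow> 'a) \<Rightarrow> real" where
  "paca_alpha m f e x u =
     ((1 / real m) * (\<Sum>i=1..m. (norm (paca_v f e x u i))\<^sup>2)) / (norm (paca_w m f e x u))\<^sup>2"

definition paca_next :: "nat \<Rightarrow> (nat \<Rightarrow> 'a::real_inner \<Rightarrow> real) \<Rightarrow> real \<Rightarrow> 'a \<Rightarrow> (nat \<Rightarrow> 'a) \<Rightarrow> 'a" where
  "paca_next m f e x u =
     (if paca_w m f e x u = 0 then x
      else x - paca_alpha m f e x u *\<^sub>R paca_w m f e x u)"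

text \<open>
  \<open>x\<close> is a sequence of iterates generated with the subgradient choices \<open>u k i\<close>.
  Stopping at a feasible iterate is encoded by keeping the sequence constant from then on;
  no choice of subgradients is made any more. The starting point \<open>x 0\<close> is unconstrained.
  The conjunct \<open>u k i \<noteq> 0\<close> is the standing assumption that the iterates are well defined.
\<close>

definition paca_run ::
  "nat \<Rightarrow> (nat \<Rightarrow> 'a::real_inner \<Rightarrow> real) \<Rightarrow> (nat \<Rightarrow> real) \<Rightarrow> (nat \<Rightarrow> 'a) \<Rightarrow> (nat \<Rightarrow> nat \<Rightarrow> 'a) \<Rightarrow> bool" where
  "paca_run m f \<epsilon> x u \<longleftrightarrow>
     (\<forall>k. if x k \<in> feasible_set m f then x (Suc k) = x k
          else (\<forall>i\<in>{1..m}. u k i \<in> subdifferential (f i) (x k) \<and>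
                           (f i (x k) + \<epsilon> k > 0 \<longrightarrow> u k i \<noteq> 0)) \<and>
               x (Suc k) = paca_next m f (\<epsilon> k) (x k) (u k))"

end

theory Submission
  imports Defs
begin

text \<open>
  Suppose that no iterate is feasible. For each \<open>i\<close> the linearisation of \<open>f i + \<epsilon> k\<close> at \<open>x k\<close>
  defines a half-space that contains every point with \<open>f i \<le> - \<epsilon> k\<close>, and \<open>paca_v\<close> is the
  displacement from the projection of \<open>x k\<close> onto it back to \<open>x k\<close>. Hence a PACA step moves
  \<open>x k\<close> closer to all points of the intersection of these half-spaces.

  By the Slater condition, continuity of the \<open>f i\<close> and \<open>\<epsilon> k \<rightarrow> 0\<close>, this intersection
  contains, from some index on, a fixed closed ball with centre \<open>z\<close> and radius \<open>r > 0\<close>.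
  Approaching a whole ball is much stronger than approaching its centre: the squared distance to
  \<open>z\<close> drops by at least \<open>2 * r\<close> times the step length (\<open>paca_next_dist_decrease\<close>). So
  the iterates stay bounded and the step lengths have a finite sum.

  On the other hand, an infeasible \<open>x k\<close> has some \<open>f j (x k) > 0\<close>, so the \<open>j\<close>-th projection
  alone moves \<open>x k\<close> by more than \<open>\<epsilon> k / norm (u k j)\<close>, and the circumcenter step is at least a
  constant multiple of that (\<open>paca_next_step_ge\<close>). Subgradients of convex functions
  are bounded on bounded sets, so the step lengths dominate a constant multiple of \<open>\<epsilon> k\<close>, and
  \<open>\<Sum>\<epsilon> k\<close> would be finite.
\<close>

section \<open>The averaged projection direction\<close>

text \<open>
  This is the obtuse-angle property of the projection onto the half-space cut out by the
  linearisation, to which \<open>y\<close> belongs by the subgradient inequality.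
\<close>

lemma paca_v_inner_ge:
  assumes sub: "u i \<in> subdifferential (f i) x"
    and nz: "f i x + e > 0 \<longrightarrow> u i \<noteq> 0"
    and y: "f i y + e \<le> 0"
  shows "(norm (paca_v f e x u i))\<^sup>2 \<le> paca_v f e x u i \<bullet> (x - y)"
proof (cases "f i x + e > 0")
  case False
  then show ?thesis by (simp add: paca_v_def)
next
  case True
  define t where "t = f i x + e"
  have t: "t > 0" and u: "norm (u i) > 0" using True nz by (auto simp: t_def)
  have v: "paca_v f e x u i = (t / (norm (u i))\<^sup>2) *\<^sub>R u i"
    using t by (simp add: paca_v_def t_def)
  have "f i x + u i \<bullet> (y - x) \<le> f i y"
    using sub by (simp add: subdifferential_def)
  then have "t \<le> u i \<bullet> (x - y)" using y by (simp add: t_def inner_diff_right)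
  then have "(t / (norm (u i))\<^sup>2) * t \<le> (t / (norm (u i))\<^sup>2) * (u i \<bullet> (x - y))"
    using t by (intro mult_left_mono) auto
  moreover have "(norm (paca_v f e x u i))\<^sup>2 = (t / (norm (u i))\<^sup>2) * t"
    using t u by (simp add: v power2_eq_square field_simps)
  ultimately show ?thesis by (simp add: v)
qed

lemma paca_w_inner_ge:
  assumes "\<And>i. i \<in> {1..m} \<Longrightarrow> u i \<in> subdifferential (f i) x"
    and "\<And>i. i \<in> {1..m} \<Longrightarrow> f i x + e > 0 \<longrightarrow> u i \<noteq> 0"
    and "\<And>i. i \<in> {1..m} \<Longrightarrow> f i y + e \<le> 0"
  shows "(1 / real m) * (\<Sum>i=1..m. (norm (paca_v f e x u i))\<^sup>2) \<le> paca_w m f e x u \<bullet> (x - y)"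
proof -
  have "(\<Sum>i=1..m. (norm (paca_v f e x u i))\<^sup>2) \<le> (\<Sum>i=1..m. paca_v f e x u i \<bullet> (x - y))"
    using assms by (intro sum_mono paca_v_inner_ge) auto
  then show ?thesis
    by (simp add: paca_w_def inner_sum_left divide_right_mono)
qed

lemma norm_paca_w_squared_le:
  "(norm (paca_w m f e x u))\<^sup>2 \<le> (1 / real m) * (\<Sum>i=1..m. (norm (paca_v f e x u i))\<^sup>2)"
proof (cases "m = 0")
  case True
  then show ?thesis by (simp add: paca_w_def)
next
  case False
  let ?v = "paca_v f e x u"
  have "(norm (\<Sum>i=1..m. ?v i))\<^sup>2 \<le> (\<Sum>i=1..m. norm (?v i))\<^sup>2"
    by (intro power_mono norm_sum) auto
  also have "\<dots> \<le> (\<Sum>i=1..m. (norm (?v i))\<^sup>2) * real m"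
    using sum_squared_le_sum_of_squares[of "\<lambda>i. norm (?v i)" "{1..m}"] by simp
  finally show ?thesis
    using False by (simp add: paca_w_def power_mult_distrib field_simps power2_eq_square)
qed

section \<open>Upper and lower bounds for a step\<close>

text \<open>
  Testing \<open>paca_w_inner_ge\<close> with the point of the ball that lies furthest in the direction of
  \<open>paca_w\<close> gains the term \<open>r * norm w\<close> over testing it with the centre. The other
  terms of the expanded square add up to at most
  \<open>- 2 * \<alpha> * A + \<alpha>\<^sup>2 * (norm w)\<^sup>2 = - \<alpha> * A \<le> 0\<close>, because \<open>\<alpha>\<close>, that is \<open>paca_alpha\<close>,
  solves \<open>\<alpha> * (norm w)\<^sup>2 = A\<close>, where \<open>A\<close> is the mean of the squared norms of the \<open>paca_v\<close>.
\<close>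

lemma paca_next_dist_decrease:
  assumes sub: "\<And>i. i \<in> {1..m} \<Longrightarrow> u i \<in> subdifferential (f i) x"
    and nz: "\<And>i. i \<in> {1..m} \<Longrightarrow> f i x + e > 0 \<longrightarrow> u i \<noteq> 0"
    and ball: "\<And>i y. i \<in> {1..m} \<Longrightarrow> y \<in> cball z r \<Longrightarrow> f i y + e \<le> 0"
    and r: "r \<ge> 0"
  shows "(norm (paca_next m f e x u - z))\<^sup>2 + 2 * r * norm (paca_next m f e x u - x)
           \<le> (norm (x - z))\<^sup>2"
proof (cases "paca_w m f e x u = 0")
  case True
  then show ?thesis by (simp add: paca_next_def)
next
  case False
  define w where "w = paca_w m f e x u"
  define A where "A = (1 / real m) * (\<Sum>i=1..m. (norm (paca_v f e x u i))\<^sup>2)"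
  define a where "a = paca_alpha m f e x u"
  have w: "norm w > 0" using False by (simp add: w_def)
  have a: "a = A / (norm w)\<^sup>2" by (simp add: a_def A_def w_def paca_alpha_def)
  have A: "A \<ge> 0" by (simp add: A_def sum_nonneg)
  have a0: "a \<ge> 0" using A by (simp add: a)
  have aw: "a * (norm w)\<^sup>2 = A" using w by (simp add: a)
  have nx: "paca_next m f e x u = x - a *\<^sub>R w"
    using False by (simp add: paca_next_def w_def a_def)
  define y where "y = z + (r / norm w) *\<^sub>R w"
  have "y \<in> cball z r" using w r by (simp add: y_def dist_norm)
  then have "A \<le> w \<bullet> (x - y)"
    unfolding A_def w_def using sub nz ball by (intro paca_w_inner_ge) auto
  also have "\<dots> = w \<bullet> (x - z) - r * norm w"
    using w by (simp add: y_def inner_diff_right inner_add_right dot_square_norm power2_eq_square)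
  finally have "a * (A + r * norm w) \<le> a * (w \<bullet> (x - z))"
    using a0 by (intro mult_left_mono) auto
  moreover have "(norm (x - a *\<^sub>R w - z))\<^sup>2
      = (norm (x - z))\<^sup>2 - 2 * (a * (w \<bullet> (x - z))) + a * (a * (norm w)\<^sup>2)"
    unfolding power2_norm_eq_inner
    by (simp add: inner_diff_left inner_diff_right inner_commute algebra_simps)
  moreover have "a * A \<ge> 0" using a0 A by simp
  moreover have "2 * r * norm (x - a *\<^sub>R w - x) = 2 * (r * (a * norm w))" using a0 by simp
  moreover have "a * (A + r * norm w) = a * A + r * (a * norm w)" by (simp add: distrib_left)
  ultimately show ?thesis unfolding nx aw by linarith
qed

text \<open>
  The step has length \<open>A / norm w\<close>, where \<open>A\<close> is the mean of the squared norms of the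
  \<open>paca_v\<close>. Convexity of the squared norm gives \<open>norm w \<le> sqrt A\<close>, so the step is at least
  \<open>sqrt A\<close>, to which the \<open>j\<close>-th projection contributes. The common point \<open>z\<close> of the half-spaces
  excludes the degenerate case \<open>w = 0\<close>, in which the projections cancel and there is no move.
\<close>

lemma paca_next_step_ge:
  assumes sub: "\<And>i. i \<in> {1..m} \<Longrightarrow> u i \<in> subdifferential (f i) x"
    and nz: "\<And>i. i \<in> {1..m} \<Longrightarrow> f i x + e > 0 \<longrightarrow> u i \<noteq> 0"
    and z: "\<And>i. i \<in> {1..m} \<Longrightarrow> f i z + e \<le> 0"
    and e: "e > 0" and j: "j \<in> {1..m}" "f j x > 0" and L: "norm (u j) \<le> L"
  shows "e / (L * sqrt (real m)) \<le> norm (paca_next m f e x u - x)"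
proof -
  define w where "w = paca_w m f e x u"
  define A where "A = (1 / real m) * (\<Sum>i=1..m. (norm (paca_v f e x u i))\<^sup>2)"
  have uj: "norm (u j) > 0" using nz[OF j(1)] j e by auto
  have L0: "L > 0" using uj L by linarith
  have m: "m > 0" using j by auto
  have "e / L \<le> (f j x + e) / norm (u j)"
    using uj L L0 e j by (intro frac_le) auto
  also have "\<dots> = norm (paca_v f e x u j)"
    using uj e j by (simp add: paca_v_def power2_eq_square)
  finally have "(e / L)\<^sup>2 \<le> (norm (paca_v f e x u j))\<^sup>2"
    using e L0 by (intro power_mono) auto
  also have "\<dots> \<le> (\<Sum>i=1..m. (norm (paca_v f e x u i))\<^sup>2)"
    using j by (intro member_le_sum) auto
  finally have "(e / L)\<^sup>2 / real m \<le> A"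
    by (simp add: A_def divide_right_mono)
  moreover have "sqrt ((e / L)\<^sup>2 / real m) = e / (L * sqrt (real m))"
    using e L0 by (simp add: real_sqrt_divide)
  ultimately have le: "e / (L * sqrt (real m)) \<le> sqrt A"
    using real_sqrt_le_mono by metis
  have "0 < e / (L * sqrt (real m))" using e L0 m by simp
  then have A: "A > 0" using le by (metis less_le_trans real_sqrt_gt_0_iff)
  have "A \<le> w \<bullet> (x - z)"
    unfolding A_def w_def using sub nz z by (intro paca_w_inner_ge) auto
  then have w: "w \<noteq> 0" using A by auto
  have "(norm w)\<^sup>2 \<le> A" unfolding A_def w_def by (rule norm_paca_w_squared_le)
  then have wA: "norm w \<le> sqrt A" by (rule real_le_rsqrt)
  have "sqrt A * norm w \<le> sqrt A * sqrt A"
    using wA A by (intro mult_left_mono) auto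
  then have "sqrt A \<le> A / norm w" using w A by (simp add: field_simps)
  also have "\<dots> = norm (paca_next m f e x u - x)"
  proof -
    have "paca_next m f e x u - x = - ((A / (norm w)\<^sup>2) *\<^sub>R w)"
      using w by (simp add: paca_next_def w_def A_def paca_alpha_def)
    then show ?thesis using w A by (simp add: power2_eq_square)
  qed
  finally show ?thesis using le by simp
qed

section \<open>Uniform bounds from convexity and the Slater point\<close>

text \<open>
  Joint continuity of \<open>f i y + \<epsilon> k\<close> as \<open>k \<rightarrow> \<infinity>\<close> and \<open>y \<rightarrow> z\<close>: the limit \<open>f i z\<close>
  is negative, and there are finitely many \<open>i\<close>.
\<close>

lemma slater_ball:
  fixes f :: "'i \<Rightarrow> 'a::metric_space \<Rightarrow> real"
  assumes "finite I" and cont: "\<And>i. i \<in> I \<Longrightarrow> isCont (f i) z"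
    and neg: "\<And>i. i \<in> I \<Longrightarrow> f i z < 0" and eps: "\<epsilon> \<longlonglongrightarrow> 0"
  obtains K :: nat and r where "r > 0"
    "\<And>k i y. k \<ge> K \<Longrightarrow> i \<in> I \<Longrightarrow> y \<in> cball z r \<Longrightarrow> f i y + \<epsilon> k \<le> 0"
proof -
  have "\<forall>\<^sub>F p in sequentially \<times>\<^sub>F nhds z. f i (snd p) + \<epsilon> (fst p) < 0" if "i \<in> I" for i
  proof (rule order_tendstoD(2))
    have "((\<lambda>p. f i (snd p)) \<longlongrightarrow> f i z) (sequentially \<times>\<^sub>F nhds z)"
      using cont[OF that] filterlim_snd by (rule isCont_tendsto_compose)
    moreover have "((\<lambda>p. \<epsilon> (fst p)) \<longlongrightarrow> 0) (sequentially \<times>\<^sub>F nhds z)"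
      using eps filterlim_fst by (rule filterlim_compose)
    ultimately show "((\<lambda>p. f i (snd p) + \<epsilon> (fst p)) \<longlongrightarrow> f i z + 0) (sequentially \<times>\<^sub>F nhds z)"
      by (rule tendsto_add)
    show "f i z + 0 < 0" using neg[OF that] by simp
  qed
  then have "\<forall>\<^sub>F p in sequentially \<times>\<^sub>F nhds z. \<forall>i\<in>I. f i (snd p) + \<epsilon> (fst p) < 0"
    using \<open>finite I\<close> by (simp add: eventually_ball_finite)
  then obtain P Q where P: "eventually P sequentially" and Q: "eventually Q (nhds z)"
    and PQ: "\<And>k y. P k \<Longrightarrow> Q y \<Longrightarrow> \<forall>i\<in>I. f i y + \<epsilon> k < 0"
    unfolding eventually_prod_filter by auto
  obtain K where K: "\<And>k. k \<ge> K \<Longrightarrow> P k" using P by (auto simp: eventually_sequentially)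
  obtain d where d: "d > 0" "\<And>y. dist y z < d \<Longrightarrow> Q y" using Q by (auto simp: eventually_nhds_metric)
  show thesis
  proof (rule that)
    show "d / 2 > 0" using d by simp
    show "f i y + \<epsilon> k \<le> 0" if "k \<ge> K" "i \<in> I" "y \<in> cball z (d / 2)" for k i y
    proof -
      have "dist y z < d" using that(3) d(1) by (simp add: dist_commute)
      then have "f i y + \<epsilon> k < 0" using PQ K d(2) that by blast
      then show ?thesis by simp
    qed
  qed
qed

text \<open>
  Moving from \<open>x\<close> by a unit vector along a subgradient \<open>u\<close> raises the function by at
  least \<open>norm u\<close>. Where it is nonnegative, an upper bound on the ball of radius \<open>R + 1\<close> is
  therefore a bound for the subgradients in the ball of radius \<open>R\<close>.
\<close>

lemma subgradients_bounded:
  fixes f :: "'i \<Rightarrow> 'a::euclidean_space \<Rightarrow> real"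
  assumes "finite I" and cont: "\<And>i. i \<in> I \<Longrightarrow> continuous_on UNIV (f i)"
  obtains L where "L > 0" "\<And>i x u. \<lbrakk>i \<in> I; x \<in> cball z R; f i x \<ge> 0; u \<in> subdifferential (f i) x\<rbrakk>
                    \<Longrightarrow> norm u \<le> L"
proof -
  have "continuous_on (cball z (R + 1)) (\<lambda>y. \<Sum>i\<in>I. \<bar>f i y\<bar>)"
    using cont by (intro continuous_intros) (auto intro: continuous_on_subset)
  then have "compact ((\<lambda>y. \<Sum>i\<in>I. \<bar>f i y\<bar>) ` cball z (R + 1))"
    by (intro compact_continuous_image) auto
  then have "bounded ((\<lambda>y. \<Sum>i\<in>I. \<bar>f i y\<bar>) ` cball z (R + 1))"
    by (rule compact_imp_bounded)
  then obtain B where B: "B > 0" "\<And>y. y \<in> cball z (R + 1) \<Longrightarrow> norm (\<Sum>i\<in>I. \<bar>f i y\<bar>) \<le> B"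
    unfolding bounded_pos by blast
  show thesis
  proof (rule that[OF B(1)])
    fix i x u
    assume i: "i \<in> I" and x: "x \<in> cball z R" and fx: "f i x \<ge> 0" and u: "u \<in> subdifferential (f i) x"
    show "norm u \<le> B"
    proof (cases "u = 0")
      case True
      then show ?thesis using B by simp
    next
      case False
      define y where "y = x + sgn u"
      have "dist z y \<le> dist z x + dist x y" by (rule dist_triangle)
      also have "dist x y = 1" using False by (simp add: y_def dist_norm norm_sgn)
      finally have y: "y \<in> cball z (R + 1)" using x by simp
      have "f i x + u \<bullet> (y - x) \<le> f i y" using u by (simp add: subdifferential_def)
      moreover have "u \<bullet> (y - x) = norm u"
        using False by (simp add: y_def sgn_div_norm dot_square_norm power2_eq_square)
      moreover have "f i y \<le> \<bar>f i y\<bar>" by simp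
      moreover have "\<bar>f i y\<bar> \<le> (\<Sum>i\<in>I. \<bar>f i y\<bar>)"
        using i \<open>finite I\<close> by (intro member_le_sum) auto
      ultimately show ?thesis using B(2)[OF y] fx by simp
    qed
  qed
qed

section \<open>Finite termination\<close>

lemma divergent_sum_no_decrease:
  fixes D \<epsilon> :: "nat \<Rightarrow> real"
  assumes D: "\<And>k. D k \<ge> 0" and c: "c > 0"
    and dec: "\<And>k. k \<ge> K \<Longrightarrow> D (Suc k) + c * \<epsilon> k \<le> D k"
    and div: "filterlim (\<lambda>N. \<Sum>k<N. \<epsilon> k) at_top sequentially"
  shows False
proof -
  define b where "b = c * (\<Sum>k<K. \<epsilon> k) + D K"
  have bound: "c * (\<Sum>k<N. \<epsilon> k) + D N \<le> b" if "N \<ge> K" for N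
    using that
  proof (induction N rule: dec_induct)
    case base
    then show ?case by (simp add: b_def)
  next
    case (step N)
    then show ?case using dec[of N] by (simp add: algebra_simps)
  qed
  have "\<forall>\<^sub>F N in sequentially. b / c < (\<Sum>k<N. \<epsilon> k) \<and> N \<ge> K"
    using div by (intro eventually_conj) (auto simp: filterlim_at_top_dense eventually_ge_at_top)
  then obtain N where "b / c < (\<Sum>k<N. \<epsilon> k)" "N \<ge> K"
    using eventually_happens by fastforce
  then show False using bound[of N] D[of N] c by (simp add: field_simps)
qed

theorem theorem6p2:
  fixes m :: nat
    and f :: "nat \<Rightarrow> real ^ 'n \<Rightarrow> real"
    and \<epsilon> :: "nat \<Rightarrow> real"
    and x :: "nat \<Rightarrow> real ^ 'n"
    and u :: "nat \<Rightarrow> nat \<Rightarrow> real ^ 'n"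
  assumes "m \<ge> 1"
    and "\<And>i. i \<in> {1..m} \<Longrightarrow> convex_on UNIV (f i)"
    and "\<And>k. \<epsilon> k > 0"
    and "\<And>k. \<epsilon> (Suc k) < \<epsilon> k"
    and "\<epsilon> \<longlonglongrightarrow> 0"
    and "filterlim (\<lambda>N. \<Sum>k<N. \<epsilon> k) at_top sequentially"
    and "\<exists>xh. \<forall>i\<in>{1..m}. f i xh < 0"
    and "paca_run m f \<epsilon> x u"
  shows "\<exists>k. x k \<in> feasible_set m f"
proof (rule ccontr)
  assume "\<not> ?thesis"
  then have infeasible: "x k \<notin> feasible_set m f" for k by blast
  have sub: "u k i \<in> subdifferential (f i) (x k)"
    and nz: "f i (x k) + \<epsilon> k > 0 \<longrightarrow> u k i \<noteq> 0" if "i \<in> {1..m}" for k i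
    using assms(8) infeasible[of k] that unfolding paca_run_def by metis+
  have nxt: "x (Suc k) = paca_next m f (\<epsilon> k) (x k) (u k)" for k
    using assms(8) infeasible[of k] unfolding paca_run_def by metis
  have cont: "continuous_on UNIV (f i)" if "i \<in> {1..m}" for i
    using assms(2)[OF that] by (intro convex_on_continuous) auto
  obtain z where z: "\<And>i. i \<in> {1..m} \<Longrightarrow> f i z < 0" using assms(7) by blast
  obtain K r where r: "r > 0"
    and ball: "\<And>k i y. k \<ge> K \<Longrightarrow> i \<in> {1..m} \<Longrightarrow> y \<in> cball z r \<Longrightarrow> f i y + \<epsilon> k \<le> 0"
  proof (rule slater_ball[where I = "{1..m}" and f = f and z = z and \<epsilon> = \<epsilon>])
    show "isCont (f i) z" if "i \<in> {1..m}" for i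
      using cont[OF that] by (simp add: continuous_on_eq_continuous_at)
  qed (use z assms(5) in auto)
  have drop: "(norm (x (Suc k) - z))\<^sup>2 + 2 * r * norm (x (Suc k) - x k) \<le> (norm (x k - z))\<^sup>2"
    if "k \<ge> K" for k
    unfolding nxt using sub nz ball[OF that] r by (intro paca_next_dist_decrease) auto
  have bounded: "x k \<in> cball z (norm (x K - z))" if "k \<ge> K" for k
    using that
  proof (induction k rule: dec_induct)
    case base
    then show ?case by (simp add: dist_norm norm_minus_commute)
  next
    case (step k)
    have "0 \<le> 2 * r * norm (x (Suc k) - x k)" using r by simp
    then have "(norm (x (Suc k) - z))\<^sup>2 \<le> (norm (x k - z))\<^sup>2"
      using drop[of k] step by linarith
    then have "norm (x (Suc k) - z) \<le> norm (x k - z)" by (rule power2_le_imp_le) simp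
    then show ?case using step by (simp add: dist_norm norm_minus_commute)
  qed
  obtain L where L: "L > 0"
    and Lu: "\<And>i y v. \<lbrakk>i \<in> {1..m}; y \<in> cball z (norm (x K - z)); f i y \<ge> 0;
                       v \<in> subdifferential (f i) y\<rbrakk> \<Longrightarrow> norm v \<le> L"
    using cont by (rule subgradients_bounded[where I = "{1..m}", rotated]) auto
  have step: "\<epsilon> k / (L * sqrt (real m)) \<le> norm (x (Suc k) - x k)" if k: "k \<ge> K" for k
  proof -
    obtain j where j: "j \<in> {1..m}" "f j (x k) > 0"
      using infeasible[of k] by (auto simp: feasible_set_def not_le)
    have "norm (u k j) \<le> L" using j sub bounded[OF k] by (intro Lu[of j "x k"]) auto
    then show ?thesis
      unfolding nxt using sub nz ball[OF k, of _ z] r j assms(3)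
      by (intro paca_next_step_ge[where z = z and j = j]) auto
  qed
  show False
  proof (rule divergent_sum_no_decrease)
    show "(norm (x k - z))\<^sup>2 \<ge> 0" for k by simp
    show "2 * r / (L * sqrt (real m)) > 0" using r L assms(1) by simp
    show "(norm (x (Suc k) - z))\<^sup>2 + 2 * r / (L * sqrt (real m)) * \<epsilon> k \<le> (norm (x k - z))\<^sup>2"
      if "k \<ge> K" for k
    proof -
      have "2 * r * (\<epsilon> k / (L * sqrt (real m))) \<le> 2 * r * norm (x (Suc k) - x k)"
        using step[OF that] r by (intro mult_left_mono) auto
      then show ?thesis using drop[OF that] by simp
    qed
  qed (rule assms(6))
qed

end
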